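(* For every positive integer $n$ and every $x\in S_n$, $$\beta(x)=\sum_{a=1}^{n-1} (x(a)-a)(n-a)=\frac{1}{2}\sum_{a=1}^n (x(a)-a)^2=\sum_{(i,j)\in I(x)} (x(i)-x(j)),$$ where $\beta(x)$ is the number of bigrassmannian permutations $w\in S_n$ with $w\le x$ in Bruhat order, and $I(x)$ is the set of inversions of $x$.
   Context: $S_n$ is the symmetric group of permutations of $\{1,\dots,n\}$, and $t_{ij}$ ($i<j$) is the transposition of $i$ and $j$; write $s_i=t_{i,i+1}$ for $1\le i\le n-1$. Products are composed so that $(xt_{ij})(a)=x(t_{ij}(a))$, i.e. right multiplication by $t_{ij}$ exchanges the values at positions $i$ and $j$. Inversions: $I(x)=\{(i,j) \mid 1\le i<j\le n,\ x(i)>x(j)\}$ for $x\in S_n$. Bruhat order: a reduction of $x$ is a permutation of the form $xt_{ij}$ with $(i,j)\in I(x)$. Define $w\le y$ if there exist $k\ge 0$ and $x_0,x_1,\dots,x_k\in S_n$ with $x_0=w$, $x_k=y$, and $x_i$ a reduction of $x_{i+1}$ for all $0\le i\le k-1$. Descents: $D_L(x)=\{s_i \mid 1\le i\le n-1,\ x^{-1}(i)>x^{-1}(i+1)\}$ and $D_R(x)=\{s_i\mid 1\le i\le n-1,\ x(i)>x(i+1)\}$. A permutation $x$ is bigrassmannian if $\#D_L(x)=\#D_R(x)=1$. $\beta(x)=\#\{w\in S_n \mid w\le x \text{ and } w \text{ is bigrassmannian}\}$. *)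

theory Defs
  imports Complex_Main "HOL-Combinatorics.Permutations"
begin

(* The symmetric group S_n is represented by the functions x :: nat => nat with
   x permutes {1..n} (they fix every number outside {1..n}), so the product is
   function composition and the inverse of x is inv x. The transposition t_ij is
   transpose i j. *)

definition inversions :: "nat \<Rightarrow> (nat \<Rightarrow> nat) \<Rightarrow> (nat \<times> nat) set" where
  "inversions n x = {(i, j). 1 \<le> i \<and> i < j \<and> j \<le> n \<and> x i > x j}"

definition is_reduction_of :: "nat \<Rightarrow> (nat \<Rightarrow> nat) \<Rightarrow> (nat \<Rightarrow> nat) \<Rightarrow> bool" where
  "is_reduction_of n w x \<longleftrightarrow> (\<exists>(i, j) \<in> inversions n x. w = x \<circ> transpose i j)"

definition bruhat_le :: "nat \<Rightarrow> (nat \<Rightarrow> nat) \<Rightarrow> (nat \<Rightarrow> nat) \<Rightarrow> bool" where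
  "bruhat_le n w y \<longleftrightarrow>
     (\<exists>(k :: nat) (c :: nat \<Rightarrow> nat \<Rightarrow> nat).
        (\<forall>i\<le>k. c i permutes {1..n}) \<and> c 0 = w \<and> c k = y \<and>
        (\<forall>i<k. is_reduction_of n (c i) (c (i + 1))))"

definition simple_transposition :: "nat \<Rightarrow> nat \<Rightarrow> nat" where
  "simple_transposition i = transpose i (i + 1)"

definition left_descents :: "nat \<Rightarrow> (nat \<Rightarrow> nat) \<Rightarrow> (nat \<Rightarrow> nat) set" where
  "left_descents n x =
     {simple_transposition i | i. 1 \<le> i \<and> i \<le> n - 1 \<and> inv x i > inv x (i + 1)}"

definition right_descents :: "nat \<Rightarrow> (nat \<Rightarrow> nat) \<Rightarrow> (nat \<Rightarrow> nat) set" where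
  "right_descents n x =
     {simple_transposition i | i. 1 \<le> i \<and> i \<le> n - 1 \<and> x i > x (i + 1)}"

definition bigrassmannian :: "nat \<Rightarrow> (nat \<Rightarrow> nat) \<Rightarrow> bool" where
  "bigrassmannian n x \<longleftrightarrow>
     x permutes {1..n} \<and> card (left_descents n x) = 1 \<and> card (right_descents n x) = 1"

definition bigrassmannian_count :: "nat \<Rightarrow> (nat \<Rightarrow> nat) \<Rightarrow> nat" where
  "bigrassmannian_count n x =
     card {w. w permutes {1..n} \<and> bruhat_le n w x \<and> bigrassmannian n w}"

end

theory Submission
  imports Defs
begin

text \<open>
  The number of bigrassmannian permutations below \<open>x\<close> is read off from the rank function
  \<open>rank x p q\<close>, the number of positions \<open>i \<le> p\<close> with \<open>x i > q\<close>. The permutation \<open>x\<close> has at least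
  \<open>p - q\<close> such positions (truncated subtraction), which is the value for the identity, and the
  excess over this value counts bigrassmannian permutations: they correspond to the triples
  \<open>(p, q, r)\<close> with \<open>1 \<le> p, q < n\<close> and \<open>p - q < r \<le> rank x p q\<close>.

  The link is the following description. A permutation with a single right descent \<open>p\<close> and a
  single left descent \<open>q\<close> is one that is not the identity and whose inversions \<open>(i, j)\<close> all satisfy
  \<open>i \<le> p < j\<close> and \<open>w j \<le> q < w i\<close> (\<open>bigrassmannian_corner\<close>, \<open>corner_perm_both_descents\<close>).
  For given \<open>p\<close> and \<open>q\<close> it is determined by \<open>r = rank w p q\<close> (\<open>corner_perm_unique\<close>): it
  exchanges two adjacent blocks, the first of length \<open>r\<close> and ending at position \<open>p\<close>. Reductions
  cannot increase the rank, so \<open>w \<le> x\<close> forces \<open>r \<le> rank x p q\<close>. Conversely, a permutation that is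
  minimal in Bruhat order below \<open>x\<close> with \<open>rank \<ge> r\<close> at \<open>(p, q)\<close> is the one belonging to
  \<open>(p, q, r)\<close>: a swap lowers the rank at \<open>(p, q)\<close>, and then by one, only if the inversion crosses
  both \<open>p\<close> and \<open>q\<close>, so at a minimal element every inversion does
  (\<open>corner_perm_below\<close>).

  Hence the count is the sum of \<open>rank x p q - rank id p q\<close> over all \<open>p\<close> and \<open>q\<close>. Summing over \<open>q\<close> gives
  the partial sums of the displacements \<open>x i - i\<close>, and summing these over \<open>p\<close> gives the weights
  \<open>n - i\<close>. The second equality is algebra, using that \<open>x\<close> rearranges the numbers \<open>1, \<dots>, n\<close>.
  For the third, \<open>x i - i\<close> is the number of inversions in which \<open>i\<close> is the left position minus the
  number in which it is the right one (\<open>displacement\<close>), so the sum of \<open>x i - x j\<close> over the inversions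
  is the sum of \<open>x i * (x i - i)\<close> over all positions.
\<close>

section \<open>Displacement and the two quadratic forms\<close>

lemma permutes_strict_less:
  assumes "x permutes S" "i \<noteq> j"
  shows "x i < x j \<or> x j < (x i :: nat)"
  using assms by (metis nat_neq_iff permutes_inj inj_eq)

text \<open>
  The \<open>x i - 1\<close> values below \<open>x i\<close> and the \<open>i - 1\<close> positions left of \<open>i\<close> share the positions \<open>j < i\<close>
  with \<open>x j < x i\<close>; what remains on either side are the inversions involving \<open>i\<close>.
\<close>
lemma displacement:
  assumes x: "x permutes {1..n}" and i: "i \<in> {1..n}"
  shows "x i + card {j\<in>{1..n}. j < i \<and> x i < x j} = i + card {j\<in>{1..n}. i < j \<and> x j < x i}"
proof -
  let ?L = "{j\<in>{1..n}. j < i \<and> x i < x j}" and ?R = "{j\<in>{1..n}. i < j \<and> x j < x i}"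
  let ?M = "{j\<in>{1..n}. j < i \<and> x j < x i}"
  have xi: "x i \<in> {1..n}" using permutes_in_image[OF x] i by blast
  have "x ` (?M \<union> ?R) = {1..<x i}"
  proof (intro equalityI subsetI)
    fix v assume "v \<in> x ` (?M \<union> ?R)"
    then obtain j where "j \<in> {1..n}" "v = x j" "x j < x i" by auto
    then show "v \<in> {1..<x i}" using permutes_in_image[OF x, of j] by auto
  next
    fix v assume v: "v \<in> {1..<x i}"
    then have "v \<in> x ` {1..n}" using permutes_image[OF x] xi by auto
    then obtain j where j: "j \<in> {1..n}" "v = x j" by auto
    then have "j \<noteq> i" using v by auto
    then show "v \<in> x ` (?M \<union> ?R)" using j v by (intro image_eqI[of _ _ j]) auto
  qed
  moreover have "card (x ` (?M \<union> ?R)) = card (?M \<union> ?R)"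
    by (intro card_image permutes_inj_on[OF x])
  moreover have "card (?M \<union> ?R) = card ?M + card ?R"
    by (intro card_Un_disjoint) auto
  ultimately have 1: "card ?M + card ?R = x i - 1" by simp
  have "?M \<union> ?L = {1..<i}"
  proof (intro equalityI subsetI)
    fix j assume j: "j \<in> {1..<i}"
    then have "x j < x i \<or> x i < x j" by (intro permutes_strict_less[OF x]) simp
    then show "j \<in> ?M \<union> ?L" using i j by auto
  qed auto
  moreover have "card (?M \<union> ?L) = card ?M + card ?L"
    by (intro card_Un_disjoint) auto
  ultimately have 2: "card ?M + card ?L = i - 1" by simp
  show ?thesis using 1 2 i xi by auto
qed

lemma sum_permutes:
  assumes "x permutes {1..n}"
  shows "(\<Sum>a=1..n. f (x a)) = (\<Sum>a=1..n. f a)"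
  using sum.permute[OF assms, of f] by (simp add: o_def)

lemma half_sum_squares:
  assumes "x permutes {1..n}"
  shows "1 / 2 * (\<Sum>a=1..n. (real (x a) - real a)\<^sup>2) = (\<Sum>a=1..n. (real a)\<^sup>2) - (\<Sum>a=1..n. real a * real (x a))"
proof -
  have "(\<Sum>a=1..n. (real (x a) - real a)\<^sup>2)
      = (\<Sum>a=1..n. (real (x a))\<^sup>2) + (\<Sum>a=1..n. (real a)\<^sup>2) - 2 * (\<Sum>a=1..n. real a * real (x a))"
    by (simp add: power2_diff sum.distrib sum_subtractf sum_distrib_left mult_ac)
  then show ?thesis using sum_permutes[OF assms, of "\<lambda>v. (real v)\<^sup>2"] by simp
qed

text \<open>
  The term for \<open>a = n\<close> vanishes, so the sum may be taken over all positions; there the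
  displacements sum to zero, which removes the constant \<open>n\<close> from the weight.
\<close>
lemma weighted_displacement_sum:
  assumes n: "n \<ge> 1" and x: "x permutes {1..n}"
  shows "(\<Sum>a=1..n-1. (real (x a) - real a) * (real n - real a))
       = 1 / 2 * (\<Sum>a=1..n. (real (x a) - real a)\<^sup>2)"
proof -
  have "(\<Sum>a=1..n. (real (x a) - real a) * (real n - real a))
      = (\<Sum>a=1..n-1. (real (x a) - real a) * (real n - real a))"
    by (intro sum.mono_neutral_right) (use n in auto)
  moreover have "(\<Sum>a=1..n. (real (x a) - real a) * (real n - real a))
      = real n * ((\<Sum>a=1..n. real (x a)) - (\<Sum>a=1..n. real a))
        + (\<Sum>a=1..n. (real a)\<^sup>2) - (\<Sum>a=1..n. real a * real (x a))"
    by (simp add: algebra_simps power2_eq_square sum.distrib sum_subtractf sum_distrib_left)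
  ultimately show ?thesis
    using half_sum_squares[OF x] sum_permutes[OF x, of real] by simp
qed

text \<open>
  Collecting the terms \<open>x i\<close> by position, each is counted once for every inversion starting at
  \<open>i\<close> and with negative sign for every inversion ending there, that is, \<open>x i - i\<close> times in total.
\<close>
lemma inversion_height_sum:
  assumes x: "x permutes {1..n}"
  shows "(\<Sum>(i, j)\<in>inversions n x. real (x i) - real (x j))
       = 1 / 2 * (\<Sum>a=1..n. (real (x a) - real a)\<^sup>2)"
proof -
  let ?P = "\<lambda>i j. i < j \<and> x j < x i"
  have I: "inversions n x = {(i, j) \<in> {1..n} \<times> {1..n}. ?P i j}"
    by (auto simp: inversions_def)
  have Is: "(\<Sum>(i, j)\<in>inversions n x. f i j)
        = (\<Sum>i=1..n. \<Sum>j=1..n. if ?P i j then f i j else 0)" for f :: "nat \<Rightarrow> nat \<Rightarrow> real"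
  proof -
    have "(\<Sum>(i, j)\<in>inversions n x. f i j)
        = (\<Sum>(i, j)\<in>{1..n} \<times> {1..n}. if ?P i j then f i j else 0)"
      by (intro sum.mono_neutral_cong_left) (auto simp: I split: if_splits)
    then show ?thesis by (simp add: sum.cartesian_product)
  qed
  have "(\<Sum>(i, j)\<in>inversions n x. real (x i)) = (\<Sum>i=1..n. real (x i) * real (card {j\<in>{1..n}. ?P i j}))"
    unfolding Is by (intro sum.cong refl) (simp add: sum.If_cases Int_def mult.commute)
  moreover have "(\<Sum>(i, j)\<in>inversions n x. real (x j)) = (\<Sum>j=1..n. real (x j) * real (card {i\<in>{1..n}. ?P i j}))"
    unfolding Is by (subst sum.swap, intro sum.cong refl) (simp add: sum.If_cases Int_def mult.commute)
  moreover have "real (card {j\<in>{1..n}. ?P i j}) - real (card {j\<in>{1..n}. ?P j i}) = real (x i) - real i"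
    if "i \<in> {1..n}" for i
    using displacement[OF x that] by linarith
  ultimately have "(\<Sum>(i, j)\<in>inversions n x. real (x i)) - (\<Sum>(i, j)\<in>inversions n x. real (x j))
      = (\<Sum>i=1..n. real (x i) * (real (x i) - real i))"
    by (simp only: sum_subtractf[symmetric] right_diff_distrib[symmetric] cong: sum.cong)
  then have "(\<Sum>(i, j)\<in>inversions n x. real (x i) - real (x j))
      = (\<Sum>i=1..n. real (x i) * (real (x i) - real i))"
    by (simp add: case_prod_beta sum_subtractf)
  also have "\<dots> = (\<Sum>i=1..n. (real (x i))\<^sup>2) - (\<Sum>i=1..n. real i * real (x i))"
    by (simp add: algebra_simps power2_eq_square sum_subtractf)
  finally show ?thesis
    using half_sum_squares[OF x] sum_permutes[OF x, of "\<lambda>v. (real v)\<^sup>2"] by simp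
qed

section \<open>The rank function and reductions\<close>

definition exceeding :: "(nat \<Rightarrow> nat) \<Rightarrow> nat \<Rightarrow> nat \<Rightarrow> nat set" where
  "exceeding x p q = {i \<in> {1..p}. q < x i}"

definition deficient :: "nat \<Rightarrow> (nat \<Rightarrow> nat) \<Rightarrow> nat \<Rightarrow> nat \<Rightarrow> nat set" where
  "deficient n x p q = {j \<in> {p<..n}. x j \<le> q}"

definition rank :: "(nat \<Rightarrow> nat) \<Rightarrow> nat \<Rightarrow> nat \<Rightarrow> nat" where
  "rank x p q = card (exceeding x p q)"

lemma finite_exceeding [simp]: "finite (exceeding x p q)"
  by (simp add: exceeding_def)

lemma finite_deficient [simp]: "finite (deficient n x p q)"
  by (simp add: deficient_def)

text \<open>
  The positions \<open>i \<le> p\<close> with \<open>x i \<le> q\<close> complete the exceeding ones to \<open>{1..p}\<close> and, under \<open>x\<close>, the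
  deficient ones to \<open>{1..q}\<close>. Consequently \<open>p - q < rank x p q\<close> in truncated subtraction says
  that both sets are nonempty.
\<close>
lemma card_deficient:
  assumes x: "x permutes {1..n}" and "p \<le> n" "q \<le> n"
  shows "card (deficient n x p q) + p = rank x p q + q"
proof -
  let ?C = "{i\<in>{1..p}. x i \<le> q}"
  have "exceeding x p q \<union> ?C = {1..p}" by (auto simp: exceeding_def)
  moreover have "card (exceeding x p q \<union> ?C) = rank x p q + card ?C"
    unfolding rank_def by (intro card_Un_disjoint) (auto simp: exceeding_def)
  ultimately have 1: "rank x p q + card ?C = p" by simp
  have "x ` (deficient n x p q \<union> ?C) = {1..q}"
  proof (intro equalityI subsetI)
    fix v assume "v \<in> x ` (deficient n x p q \<union> ?C)"
    then obtain j where "j \<in> deficient n x p q \<union> ?C" "v = x j" by blast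
    moreover from this have "j \<in> {1..n}" "x j \<le> q" using assms by (auto simp: deficient_def)
    ultimately show "v \<in> {1..q}" using permutes_in_image[OF x, of j] by auto
  next
    fix v assume v: "v \<in> {1..q}"
    then have "v \<in> x ` {1..n}" using permutes_image[OF x] assms by auto
    then obtain j where j: "j \<in> {1..n}" "v = x j" by auto
    then show "v \<in> x ` (deficient n x p q \<union> ?C)"
      using v by (intro image_eqI[of _ _ j]) (auto simp: deficient_def)
  qed
  moreover have "card (x ` (deficient n x p q \<union> ?C)) = card (deficient n x p q \<union> ?C)"
    by (intro card_image permutes_inj_on[OF x])
  moreover have "card (deficient n x p q \<union> ?C) = card (deficient n x p q) + card ?C"
    by (intro card_Un_disjoint) (auto simp: deficient_def)
  ultimately show ?thesis using 1 by simp
qed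

definition crosses :: "nat \<Rightarrow> nat \<Rightarrow> (nat \<Rightarrow> nat) \<Rightarrow> nat \<Rightarrow> nat \<Rightarrow> bool" where
  "crosses p q x i j \<longleftrightarrow> i \<le> p \<and> p < j \<and> x j \<le> q \<and> q < x i"

lemma rank_swap_crossing:
  assumes "(i, j) \<in> inversions n x" "crosses p q x i j"
  shows "rank (x \<circ> transpose i j) p q = rank x p q - 1"
proof -
  have "exceeding (x \<circ> transpose i j) p q = exceeding x p q - {i}"
    using assms by (auto simp: exceeding_def crosses_def inversions_def transpose_def)
  moreover have "i \<in> exceeding x p q"
    using assms by (auto simp: exceeding_def crosses_def inversions_def)
  ultimately show ?thesis by (simp add: rank_def)
qed

text \<open>
  If both positions lie on the same side of \<open>p\<close>, the swap only permutes positions on that side; if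
  they lie on different sides but their values lie on the same side of \<open>q\<close>, it exchanges two positions
  that are both exceeding in value or both not.
\<close>
lemma rank_swap_not_crossing:
  assumes ij: "(i, j) \<in> inversions n x" and nc: "\<not> crosses p q x i j"
  shows "rank (x \<circ> transpose i j) p q = rank x p q"
proof -
  have ij': "1 \<le> i" "i < j" "x j < x i" using ij by (auto simp: inversions_def)
  consider "j \<le> p" | "p < i" | "i \<le> p" "p < j" by linarith
  then show ?thesis
  proof cases
    case 1
    have "exceeding (x \<circ> transpose i j) p q = transpose i j ` exceeding x p q"
    proof (intro equalityI subsetI)
      fix k assume "k \<in> exceeding (x \<circ> transpose i j) p q"
      then show "k \<in> transpose i j ` exceeding x p q"
        using 1 ij' by (intro image_eqI[of _ _ "transpose i j k"])
          (auto simp: exceeding_def transpose_def split: if_splits)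
    next
      fix k assume "k \<in> transpose i j ` exceeding x p q"
      then show "k \<in> exceeding (x \<circ> transpose i j) p q"
        using 1 ij' by (auto simp: exceeding_def transpose_def split: if_splits)
    qed
    then show ?thesis by (simp add: rank_def card_image)
  next
    case 2
    then have "exceeding (x \<circ> transpose i j) p q = exceeding x p q"
      using ij' by (auto simp: exceeding_def transpose_def)
    then show ?thesis by (simp add: rank_def)
  next
    case 3
    then have "exceeding (x \<circ> transpose i j) p q = exceeding x p q"
      using ij' nc by (auto simp: exceeding_def transpose_def crosses_def split: if_splits)
    then show ?thesis by (simp add: rank_def)
  qed
qed

lemma rank_reduction_le:
  assumes "is_reduction_of n w x"
  shows "rank w p q \<le> rank x p q"
proof -
  obtain i j where ij: "(i, j) \<in> inversions n x" "w = x \<circ> transpose i j"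
    using assms unfolding is_reduction_of_def by blast
  show ?thesis
    using rank_swap_crossing[OF ij(1), of p q] rank_swap_not_crossing[OF ij(1), of p q]
    unfolding ij(2) by linarith
qed

lemma rank_mono_bruhat:
  assumes "bruhat_le n w x"
  shows "rank w p q \<le> rank x p q"
proof -
  obtain k :: nat and c :: "nat \<Rightarrow> nat \<Rightarrow> nat" where c: "c 0 = w" "c k = x"
    and red: "\<forall>i<k. is_reduction_of n (c i) (c (i + 1))"
    using assms unfolding bruhat_le_def by blast
  have "rank (c 0) p q \<le> rank (c i) p q" if "i \<le> k" for i
    using that
  proof (induction i)
    case (Suc i)
    then show ?case
      using rank_reduction_le[of n "c i" "c (Suc i)" p q] red by simp
  qed simp
  from this[of k] show ?thesis using c by simp
qed

lemma bruhat_le_refl: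
  assumes "x permutes {1..n}"
  shows "bruhat_le n x x"
  unfolding bruhat_le_def by (intro exI[of _ 0] exI[of _ "\<lambda>_. x"]) (use assms in auto)

lemma bruhat_le_reduction:
  assumes "bruhat_le n w y" "is_reduction_of n y x" "x permutes {1..n}"
  shows "bruhat_le n w x"
proof -
  obtain k :: nat and c :: "nat \<Rightarrow> nat \<Rightarrow> nat" where perm: "\<forall>i\<le>k. c i permutes {1..n}"
    and c: "c 0 = w" "c k = y" and red: "\<forall>i<k. is_reduction_of n (c i) (c (i + 1))"
    using assms(1) unfolding bruhat_le_def by blast
  let ?c = "c(Suc k := x)"
  have "?c i permutes {1..n}" if "i \<le> Suc k" for i
    using perm assms(3) that by (cases "i = Suc k") simp_all
  moreover have "is_reduction_of n (?c i) (?c (i + 1))" if "i < Suc k" for i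
    using red assms(2) c that by (cases "i = k") simp_all
  moreover have "?c 0 = w" "?c (Suc k) = x" using c by simp_all
  ultimately have "(\<forall>i\<le>Suc k. ?c i permutes {1..n}) \<and> ?c 0 = w \<and> ?c (Suc k) = x \<and>
      (\<forall>i<Suc k. is_reduction_of n (?c i) (?c (i + 1)))"
    by blast
  then show ?thesis
    unfolding bruhat_le_def by (intro exI[of _ "Suc k"] exI[of _ ?c])
qed

lemma reduction_permutes:
  assumes "(i, j) \<in> inversions n x" "x permutes {1..n}"
  shows "x \<circ> transpose i j permutes {1..n}"
  using assms by (intro permutes_compose permutes_swap_id) (auto simp: inversions_def)

text \<open>
  This sum serves as the termination measure of the descent in Bruhat order; its weights
  decrease with the position, so moving the larger value to the right lowers it.
\<close>
lemma reduction_decreases: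
  assumes ij: "(i, j) \<in> inversions n x"
  shows "(\<Sum>a=1..n. (n - a) * (x \<circ> transpose i j) a) < (\<Sum>a=1..n. (n - a) * x a)"
proof -
  have ij': "i \<in> {1..n}" "j \<in> {1..n} - {i}" "i < j" "x j < x i" "j \<le> n"
    using ij by (auto simp: inversions_def)
  have split: "(\<Sum>a=1..n. f a) = f i + (f j + (\<Sum>a\<in>{1..n} - {i} - {j}. f a))" for f :: "nat \<Rightarrow> nat"
    using sum.remove[of "{1..n}" i f] sum.remove[of "{1..n} - {i}" j f] ij'(1,2) by simp
  have "(\<Sum>a\<in>{1..n} - {i} - {j}. (n - a) * (x \<circ> transpose i j) a) = (\<Sum>a\<in>{1..n} - {i} - {j}. (n - a) * x a)"
    by (intro sum.cong) auto
  moreover have "(n - i) * x j + (n - j) * x i < (n - i) * x i + (n - j) * x j"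
  proof -
    obtain d where d: "x i = x j + d" "d > 0"
      using less_imp_add_positive[OF ij'(4)] by metis
    have "n - j < n - i" using ij' by linarith
    then have "(n - j) * d < (n - i) * d" using d by simp
    then show ?thesis using d by (simp add: algebra_simps)
  qed
  ultimately show ?thesis unfolding split by simp
qed

section \<open>Permutations all of whose inversions cross a corner\<close>

text \<open>
  Together with \<open>w \<noteq> id\<close>, this is the condition that \<open>p\<close> is the only right descent and \<open>q\<close> the only
  left descent. In terms of inversions it is visibly what remains when no swap can keep the rank
  at \<open>(p, q)\<close>.
\<close>
definition corner_perm :: "nat \<Rightarrow> nat \<Rightarrow> nat \<Rightarrow> (nat \<Rightarrow> nat) \<Rightarrow> bool" where
  "corner_perm n p q w \<longleftrightarrow> w permutes {1..n} \<and> (\<forall>(i, j)\<in>inversions n w. crosses p q w i j)"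

lemma rank_excess_nonempty:
  assumes "x permutes {1..n}" "p \<le> n" "q \<le> n" "p - q < rank x p q"
  obtains i j where "i \<in> {1..p}" "q < x i" "j \<in> {p<..n}" "x j \<le> q"
proof -
  have "exceeding x p q \<noteq> {}" using assms(4) by (auto simp: rank_def)
  moreover have "deficient n x p q \<noteq> {}" using card_deficient[OF assms(1-3)] assms(4) by auto
  ultimately show ?thesis using that by (auto simp: exceeding_def deficient_def)
qed

text \<open>
  Descent from \<open>x\<close> by reductions that keep the rank at least \<open>r\<close>. When none is left, every inversion
  crosses \<open>(p, q)\<close> and its swap lowers the rank from \<open>r\<close> to \<open>r - 1\<close>. The bound \<open>p - q < r\<close> is what
  provides an inversion at that point, so that the rank is known to be exactly \<open>r\<close>.
\<close>
lemma corner_perm_below: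
  assumes "x permutes {1..n}" "p \<le> n" "q \<le> n" "p - q < r" "r \<le> rank x p q"
  shows "\<exists>w. bruhat_le n w x \<and> corner_perm n p q w \<and> rank w p q = r"
  using assms
proof (induction "\<Sum>a=1..n. (n - a) * x a" arbitrary: x rule: less_induct)
  case less
  show ?case
  proof (cases "\<exists>(i, j)\<in>inversions n x. r \<le> rank (x \<circ> transpose i j) p q")
    case True
    then obtain i j where ij: "(i, j) \<in> inversions n x" "r \<le> rank (x \<circ> transpose i j) p q" by blast
    obtain w where w: "bruhat_le n w (x \<circ> transpose i j)" "corner_perm n p q w" "rank w p q = r"
      using less.hyps[OF reduction_decreases reduction_permutes] ij less.prems by blast
    have "is_reduction_of n (x \<circ> transpose i j) x" using ij by (auto simp: is_reduction_of_def)
    then show ?thesis using bruhat_le_reduction w less.prems by blast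
  next
    case False
    have cross: "crosses p q x i j \<and> rank x p q = r" if "(i, j) \<in> inversions n x" for i j
    proof -
      have "\<not> r \<le> rank (x \<circ> transpose i j) p q" using False that by blast
      moreover from this have "crosses p q x i j"
        using rank_swap_not_crossing[OF that] less.prems by fastforce
      ultimately show ?thesis using rank_swap_crossing[OF that] less.prems by fastforce
    qed
    have "p - q < rank x p q" using less.prems by simp
    then obtain i j where "i \<in> {1..p}" "q < x i" "j \<in> {p<..n}" "x j \<le> q"
      using rank_excess_nonempty less.prems by metis
    then have "(i, j) \<in> inversions n x" by (auto simp: inversions_def)
    then have "rank x p q = r" using cross by blast
    moreover have "corner_perm n p q x" using cross less.prems by (auto simp: corner_perm_def)
    ultimately show ?thesis using bruhat_le_refl less.prems by blast
  qed
qed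

lemma corner_perm_crosses:
  assumes "corner_perm n p q w" "1 \<le> i" "i < j" "j \<le> n" "w j < w i"
  shows "crosses p q w i j"
proof -
  have "(i, j) \<in> inversions n w" using assms(2-5) by (simp add: inversions_def)
  then show ?thesis using assms(1) unfolding corner_perm_def by blast
qed

text \<open>
  Without inversions inside \<open>{1..p}\<close>, the exceeding positions form a block ending at \<open>p\<close>; in the
  same way the deficient positions form a block starting at \<open>p + 1\<close>.
\<close>
lemma corner_perm_exceeding:
  assumes w: "corner_perm n p q w" and i: "i \<in> exceeding w p q" "i \<le> i'" "i' \<le> p" "p \<le> n"
  shows "i' \<in> exceeding w p q"
proof (rule ccontr)
  assume i': "i' \<notin> exceeding w p q"
  have "1 \<le> i" "q < w i" using i(1) by (simp_all add: exceeding_def)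
  moreover from this have "w i' \<le> q" using i' i(2,3) by (simp add: exceeding_def)
  moreover have "i \<noteq> i'" using i(1) i' by metis
  ultimately have "crosses p q w i i'" using i(2-4) by (intro corner_perm_crosses[OF w]) linarith+
  then show False using i(3) by (simp add: crosses_def)
qed

lemma corner_perm_deficient:
  assumes w: "corner_perm n p q w" and j: "j \<in> deficient n w p q" "j' \<le> j" "p < j'"
  shows "j' \<in> deficient n w p q"
proof (rule ccontr)
  assume j': "j' \<notin> deficient n w p q"
  have "j \<le> n" "w j \<le> q" using j(1) by (simp_all add: deficient_def)
  moreover from this have "q < w j'" using j' j(2,3) by (simp add: deficient_def)
  moreover have "j \<noteq> j'" using j(1) j' by metis
  ultimately have "crosses p q w j' j" using j(2,3) by (intro corner_perm_crosses[OF w]) linarith+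
  then show False using j(3) by (simp add: crosses_def)
qed

text \<open>
  The inversions are exactly the pairs of an exceeding and a deficient position, so the
  displacement formula gives the values: exceeding positions move up by the length of the deficient
  block, deficient ones down by the length of the exceeding block, and all others are fixed.
\<close>
lemma corner_perm_value:
  assumes w: "corner_perm n p q w" and k: "k \<in> {1..n}" and p: "p \<le> n"
  shows "w k + (if k \<in> deficient n w p q then card (exceeding w p q) else 0)
       = k + (if k \<in> exceeding w p q then card (deficient n w p q) else 0)"
proof -
  have perm: "w permutes {1..n}" using w by (simp add: corner_perm_def)
  have cr: "i \<le> p \<and> p < j \<and> w j \<le> q \<and> q < w i"
    if "i \<in> {1..n}" "i < j" "j \<in> {1..n}" "w j < w i" for i j
    using corner_perm_crosses[OF w _ that(2) _ that(4)] that by (simp add: crosses_def)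
  have "{j\<in>{1..n}. j < k \<and> w k < w j} = (if k \<in> deficient n w p q then exceeding w p q else {})"
  proof (intro equalityI subsetI)
    fix i assume "i \<in> {j\<in>{1..n}. j < k \<and> w k < w j}"
    then show "i \<in> (if k \<in> deficient n w p q then exceeding w p q else {})"
      using cr[of i k] k by (simp add: exceeding_def deficient_def)
  next
    fix i assume "i \<in> (if k \<in> deficient n w p q then exceeding w p q else {})"
    then show "i \<in> {j\<in>{1..n}. j < k \<and> w k < w j}"
      using p by (simp add: exceeding_def deficient_def split: if_splits)
  qed
  moreover have "{j\<in>{1..n}. k < j \<and> w j < w k} = (if k \<in> exceeding w p q then deficient n w p q else {})"
  proof (intro equalityI subsetI)
    fix j assume "j \<in> {j\<in>{1..n}. k < j \<and> w j < w k}"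
    then show "j \<in> (if k \<in> exceeding w p q then deficient n w p q else {})"
      using cr[of k j] k by (simp add: exceeding_def deficient_def)
  next
    fix j assume "j \<in> (if k \<in> exceeding w p q then deficient n w p q else {})"
    then show "j \<in> {j\<in>{1..n}. k < j \<and> w j < w k}"
      using k by (simp add: exceeding_def deficient_def split: if_splits)
  qed
  ultimately show ?thesis using displacement[OF perm k] by (simp split: if_splits)
qed

text \<open>
  The rank is the length of the exceeding block and, by \<open>card_deficient\<close>, also determines the
  length of the deficient one. Blocks with a common end are nested, so equal length makes them equal.
\<close>
lemma corner_perm_unique:
  assumes w: "corner_perm n p q w" and v: "corner_perm n p q v"
    and rk: "rank w p q = rank v p q" and pq: "p \<le> n" "q \<le> n"
  shows "w = v"
proof -
  have pw: "w permutes {1..n}" and pv: "v permutes {1..n}" using w v by (auto simp: corner_perm_def)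
  have "exceeding w p q \<subseteq> exceeding v p q \<or> exceeding v p q \<subseteq> exceeding w p q"
  proof (rule ccontr)
    assume "\<not> ?thesis"
    then obtain a b where "a \<in> exceeding w p q" "a \<notin> exceeding v p q"
      "b \<in> exceeding v p q" "b \<notin> exceeding w p q" by blast
    then show False
      using corner_perm_exceeding[OF w, of a b] corner_perm_exceeding[OF v, of b a] pq
      by (auto simp: exceeding_def) (meson nat_le_linear)
  qed
  then have A: "exceeding w p q = exceeding v p q"
    using rk card_subset_eq[OF finite_exceeding] unfolding rank_def by metis
  have cB: "card (deficient n w p q) = card (deficient n v p q)"
    using card_deficient[OF pw pq] card_deficient[OF pv pq] rk by simp
  have "deficient n w p q \<subseteq> deficient n v p q \<or> deficient n v p q \<subseteq> deficient n w p q"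
  proof (rule ccontr)
    assume "\<not> ?thesis"
    then obtain a b where "a \<in> deficient n w p q" "a \<notin> deficient n v p q"
      "b \<in> deficient n v p q" "b \<notin> deficient n w p q" by blast
    then show False
      using corner_perm_deficient[OF w, of a b] corner_perm_deficient[OF v, of b a] pq
      by (auto simp: deficient_def) (meson nat_le_linear)
  qed
  then have B: "deficient n w p q = deficient n v p q"
    using cB card_subset_eq[OF finite_deficient] by metis
  show ?thesis
  proof
    fix k
    show "w k = v k"
    proof (cases "k \<in> {1..n}")
      case True
      then show ?thesis
        using corner_perm_value[OF w True pq(1)] corner_perm_value[OF v True pq(1)] A B
        by (simp split: if_splits)
    next
      case False
      then show ?thesis using pw pv by (simp add: permutes_def)
    qed
  qed
qed

section \<open>Bigrassmannian permutations\<close>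

text \<open>
  Indices in place of simple transpositions: the two descent sets in the definition of
  bigrassmannian are the images of \<open>descents n (inv x)\<close> and \<open>descents n x\<close> under the injective map
  \<open>i \<mapsto> s\<^sub>i\<close>.
\<close>
definition descents :: "nat \<Rightarrow> (nat \<Rightarrow> nat) \<Rightarrow> nat set" where
  "descents n x = {i. 1 \<le> i \<and> i \<le> n - 1 \<and> x (i + 1) < x i}"

lemma inj_simple_transposition: "inj simple_transposition"
proof (rule injI)
  fix i j assume eq: "simple_transposition i = simple_transposition j"
  have "simple_transposition j i = i + 1"
    using fun_cong[OF eq, of i] by (simp add: simple_transposition_def)
  then have "(if i = j then j + 1 else if i = j + 1 then j else i) = i + 1"
    by (simp only: simple_transposition_def transpose_def)
  then show "i = j" by presburger
qed

lemma bigrassmannian_iff: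
  "bigrassmannian n x \<longleftrightarrow>
     x permutes {1..n} \<and> card (descents n (inv x)) = 1 \<and> card (descents n x) = 1"
proof -
  have "right_descents n x = simple_transposition ` descents n x"
    "left_descents n x = simple_transposition ` descents n (inv x)"
    by (auto simp: right_descents_def left_descents_def descents_def)
  moreover have "card (simple_transposition ` S) = card S" for S
    by (intro card_image inj_on_subset[OF inj_simple_transposition]) auto
  ultimately show ?thesis by (simp add: bigrassmannian_def)
qed

lemma inversion_straddles_descent:
  assumes "(i, j) \<in> inversions n x"
  obtains d where "d \<in> descents n x" "i \<le> d" "d < j"
proof -
  have ij: "1 \<le> i" "i < j" "j \<le> n" "x j < x i" using assms by (auto simp: inversions_def)
  have "\<exists>d. i \<le> d \<and> d < j \<and> x (Suc d) < x d"
  proof (rule ccontr)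
    assume "\<not> ?thesis"
    then have *: "x d \<le> x (Suc d)" if "i \<le> d" "d < j" for d using that not_le by blast
    have "x i \<le> x k" if "i \<le> k" "k \<le> j" for k
      using that by (induction k rule: dec_induct) (auto intro: order_trans[OF _ *])
    from this[of j] show False using ij by simp
  qed
  then obtain d where "i \<le> d" "d < j" "x (Suc d) < x d" by blast
  moreover from this have "d \<in> descents n x" using ij by (auto simp: descents_def)
  ultimately show ?thesis using that by blast
qed

lemma inversions_inv:
  assumes "x permutes {1..n}" "(i, j) \<in> inversions n x"
  shows "(x j, x i) \<in> inversions n (inv x)"
proof -
  have "1 \<le> i" "i < j" "j \<le> n" "x j < x i" using assms(2) by (auto simp: inversions_def)
  moreover from this have "x i \<in> {1..n}" "x j \<in> {1..n}"
    unfolding permutes_in_image[OF assms(1)] by simp_all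
  ultimately show ?thesis by (simp add: inversions_def permutes_inverses(2)[OF assms(1)])
qed

lemma corner_perm_inv:
  assumes "corner_perm n p q w"
  shows "corner_perm n q p (inv w)"
proof -
  have pw: "w permutes {1..n}" using assms by (simp add: corner_perm_def)
  have "crosses q p (inv w) a b" if "(a, b) \<in> inversions n (inv w)" for a b
  proof -
    have "(inv w b, inv w a) \<in> inversions n w"
      using inversions_inv[OF permutes_inv[OF pw] that] permutes_inv_inv[OF pw] by simp
    then show ?thesis
      using assms permutes_inverses[OF pw] by (auto simp: corner_perm_def crosses_def)
  qed
  then show ?thesis using permutes_inv[OF pw] by (auto simp: corner_perm_def)
qed

lemma corner_perm_descents:
  assumes w: "corner_perm n p q w" and i: "i \<in> {1..p}" "q < w i" and j: "j \<in> {p<..n}" "w j \<le> q"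
  shows "descents n w = {p}"
proof -
  have "i \<in> exceeding w p q" "j \<in> deficient n w p q"
    using i j by (auto simp: exceeding_def deficient_def)
  then have "p \<in> exceeding w p q" "p + 1 \<in> deficient n w p q"
    using corner_perm_exceeding[OF w, of i p] corner_perm_deficient[OF w, of j "p + 1"] i j by auto
  then have "p \<in> descents n w" by (auto simp: descents_def exceeding_def deficient_def)
  moreover have "d = p" if "d \<in> descents n w" for d
  proof -
    have "(d, d + 1) \<in> inversions n w" using that by (auto simp: descents_def inversions_def)
    then show ?thesis using w by (auto simp: corner_perm_def crosses_def)
  qed
  ultimately show ?thesis by blast
qed

lemma corner_perm_both_descents:
  assumes w: "corner_perm n p q w" and pq: "p \<le> n" "q \<le> n" and rk: "p - q < rank w p q"
  shows "descents n w = {p}" "descents n (inv w) = {q}"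
proof -
  have pw: "w permutes {1..n}" using w by (simp add: corner_perm_def)
  obtain i j where ij: "i \<in> {1..p}" "q < w i" "j \<in> {p<..n}" "w j \<le> q"
    using rank_excess_nonempty[OF pw pq rk] by metis
  show "descents n w = {p}" using corner_perm_descents[OF w] ij by blast
  have "w j \<in> {1..q}" "w i \<in> {q<..n}"
    using ij pq permutes_in_image[OF pw, of i] permutes_in_image[OF pw, of j] by auto
  moreover have "p < inv w (w j)" "inv w (w i) \<le> p"
    using ij permutes_inverses[OF pw] by auto
  ultimately show "descents n (inv w) = {q}"
    using corner_perm_descents[OF corner_perm_inv[OF w]] by blast
qed

text \<open>
  Every inversion straddles a descent in position, and its mirror image under \<open>inv\<close> straddles one in
  value; uniqueness of the descents leaves only \<open>p\<close> and \<open>q\<close>. The descent at \<open>p\<close> is itself such an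
  inversion, which makes the exceeding and the deficient set nonempty.
\<close>
lemma bigrassmannian_corner:
  assumes "bigrassmannian n w"
  obtains p q where "p \<in> {1..n-1}" "q \<in> {1..n-1}" "corner_perm n p q w" "p - q < rank w p q"
proof -
  have pw: "w permutes {1..n}" using assms by (simp add: bigrassmannian_iff)
  obtain p q where pq: "descents n w = {p}" "descents n (inv w) = {q}"
    using assms by (auto simp: bigrassmannian_iff card_1_singleton_iff)
  have in': "p \<in> {1..n-1}" "q \<in> {1..n-1}" "w (p + 1) < w p" using pq by (auto simp: descents_def)
  have cr: "crosses p q w i j" if ij: "(i, j) \<in> inversions n w" for i j
  proof -
    obtain d where "d \<in> descents n w" "i \<le> d" "d < j"
      using inversion_straddles_descent[OF ij] .
    moreover obtain e where "e \<in> descents n (inv w)" "w j \<le> e" "e < w i"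
      using inversion_straddles_descent[OF inversions_inv[OF pw ij]] .
    ultimately have "i \<le> p" "p < j" "w j \<le> q" "q < w i" unfolding pq by simp_all
    then show ?thesis by (simp add: crosses_def)
  qed
  then have cp: "corner_perm n p q w" using pw by (auto simp: corner_perm_def)
  have "(p, p + 1) \<in> inversions n w" using in' by (auto simp: inversions_def)
  then have "crosses p q w p (p + 1)" using cr by blast
  then have "p \<in> exceeding w p q" "p + 1 \<in> deficient n w p q"
    using in' by (auto simp: crosses_def exceeding_def deficient_def)
  then have "card (exceeding w p q) > 0" "card (deficient n w p q) > 0"
    by (auto simp: card_gt_0_iff)
  then have "p - q < rank w p q"
    using card_deficient[OF pw, of p q] in' unfolding rank_def atLeastAtMost_iff by linarith
  then show ?thesis using that in' cp by blast
qed

section \<open>Counting\<close>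

text \<open>
  The triple \<open>(p, q, r)\<close> is recovered from the permutation as its right descent, its left descent and
  its rank there, which gives injectivity.
\<close>
lemma bigrassmannian_count_ranks:
  assumes x: "x permutes {1..n}"
  shows "bigrassmannian_count n x = (\<Sum>p=1..n-1. \<Sum>q=1..n-1. rank x p q - (p - q))"
proof -
  let ?T = "SIGMA p:{1..n-1}. SIGMA q:{1..n-1}. {p - q<..rank x p q}"
  let ?W = "{w. w permutes {1..n} \<and> bruhat_le n w x \<and> bigrassmannian n w}"
  have "\<forall>t\<in>?T. \<exists>w. case t of (p, q, r) \<Rightarrow> bruhat_le n w x \<and> corner_perm n p q w \<and> rank w p q = r"
    using corner_perm_below[OF x] by auto
  then obtain g where "\<forall>t\<in>?T. case t of (p, q, r) \<Rightarrow>
      bruhat_le n (g t) x \<and> corner_perm n p q (g t) \<and> rank (g t) p q = r"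
    using bchoice by meson
  then have "bruhat_le n (g (p, q, r)) x \<and> corner_perm n p q (g (p, q, r)) \<and> rank (g (p, q, r)) p q = r"
    if "(p, q, r) \<in> ?T" for p q r
    using that by (fastforce dest: bspec)
  then have g: "bruhat_le n (g (p, q, r)) x" "corner_perm n p q (g (p, q, r))"
      "rank (g (p, q, r)) p q = r" if "(p, q, r) \<in> ?T" for p q r
    using that by simp_all
  have desc: "descents n (g (p, q, r)) = {p}" "descents n (inv (g (p, q, r))) = {q}"
    if "(p, q, r) \<in> ?T" for p q r
    using corner_perm_both_descents[OF g(2)[OF that]] g(3)[OF that] that by auto
  have "inj_on g ?T"
  proof (rule inj_onI)
    fix s t assume st: "s \<in> ?T" "t \<in> ?T" "g s = g t"
    obtain p q r p' q' r' where s: "s = (p, q, r)" and t: "t = (p', q', r')" by (metis prod_cases3)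
    note st = st[unfolded s t]
    have "p = p'" "q = q'" using desc[OF st(1)] desc[OF st(2)] unfolding st(3) by simp_all
    moreover from this have "r = r'" using g(3)[OF st(1)] g(3)[OF st(2)] unfolding st(3) by simp
    ultimately show "s = t" by (simp add: s t)
  qed
  moreover have "g ` ?T = ?W"
  proof (intro equalityI subsetI)
    fix w assume "w \<in> g ` ?T"
    then obtain p q r where t: "(p, q, r) \<in> ?T" "w = g (p, q, r)" by auto
    then show "w \<in> ?W"
      using g[OF t(1)] desc[OF t(1)] by (auto simp: bigrassmannian_iff corner_perm_def)
  next
    fix w assume w: "w \<in> ?W"
    then obtain p q where pq: "p \<in> {1..n-1}" "q \<in> {1..n-1}" "corner_perm n p q w" "p - q < rank w p q"
      using bigrassmannian_corner by blast
    have t: "(p, q, rank w p q) \<in> ?T" using pq w rank_mono_bruhat by auto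
    have "w = g (p, q, rank w p q)"
      using corner_perm_unique[OF pq(3) g(2)[OF t]] g(3)[OF t] pq by auto
    then show "w \<in> g ` ?T" using t by blast
  qed
  ultimately have "card ?W = card ?T" by (metis (lifting) card_image)
  then show ?thesis by (simp add: bigrassmannian_count_def)
qed

text \<open>
  Position \<open>i\<close> is exceeding for the \<open>x i - 1\<close> values of \<open>q\<close> below \<open>x i\<close>.
\<close>
lemma sum_rank:
  assumes x: "x permutes {1..n}" and p: "p \<le> n"
  shows "(\<Sum>q=1..n-1. real (rank x p q)) = (\<Sum>i=1..p. real (x i) - 1)"
proof -
  have "(\<Sum>q=1..n-1. real (rank x p q)) = (\<Sum>q=1..n-1. \<Sum>i=1..p. if q < x i then 1 else 0)"
    by (simp add: rank_def exceeding_def sum.If_cases Int_def)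
  also have "\<dots> = (\<Sum>i=1..p. \<Sum>q=1..n-1. if q < x i then 1 else 0)"
    by (rule sum.swap)
  also have "\<dots> = (\<Sum>i=1..p. real (x i) - 1)"
  proof (intro sum.cong refl)
    fix i assume "i \<in> {1..p}"
    then have xi: "x i \<in> {1..n}" using permutes_in_image[OF x, of i] p by auto
    have "{1..n-1} \<inter> {q. q < x i} = {1..<x i}" using xi by auto
    then show "(\<Sum>q=1..n-1. if q < x i then 1 else 0) = real (x i) - 1"
      using xi by (simp add: sum.If_cases of_nat_diff)
  qed
  finally show ?thesis .
qed

lemma rank_id: "rank id p q = p - q"
proof -
  have "exceeding id p q = {q<..p}" by (auto simp: exceeding_def)
  then show ?thesis by (simp add: rank_def)
qed

lemma rank_ge_id:
  assumes "x permutes {1..n}" "p \<le> n" "q \<le> n"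
  shows "p - q \<le> rank x p q"
  using card_deficient[OF assms] by linarith

lemma sum_partial_sums:
  fixes f :: "nat \<Rightarrow> real"
  shows "(\<Sum>p=1..n-1. \<Sum>i=1..p. f i) = (\<Sum>i=1..n-1. f i * (real n - real i))"
proof -
  have "(\<Sum>p=1..n-1. \<Sum>i=1..p. f i) = (\<Sum>p=1..n-1. \<Sum>i=1..n-1. if i \<le> p then f i else 0)"
    by (intro sum.cong refl sum.mono_neutral_cong_left) auto
  also have "\<dots> = (\<Sum>i=1..n-1. \<Sum>p=1..n-1. if i \<le> p then f i else 0)"
    by (rule sum.swap)
  also have "\<dots> = (\<Sum>i=1..n-1. f i * (real n - real i))"
  proof (intro sum.cong refl)
    fix i assume i: "i \<in> {1..n-1}"
    then have "{1..n-1} \<inter> {p. i \<le> p} = {i..<n}" by auto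
    moreover have "real (n - i) = real n - real i" using i by (intro of_nat_diff) auto
    ultimately show "(\<Sum>p=1..n-1. if i \<le> p then f i else 0) = f i * (real n - real i)"
      by (simp add: sum.If_cases)
  qed
  finally show ?thesis .
qed

lemma bigrassmannian_count_weighted:
  assumes x: "x permutes {1..n}"
  shows "real (bigrassmannian_count n x) = (\<Sum>a=1..n-1. (real (x a) - real a) * (real n - real a))"
proof -
  have "real (bigrassmannian_count n x)
      = (\<Sum>p=1..n-1. \<Sum>q=1..n-1. real (rank x p q) - real (rank id p q))"
    unfolding bigrassmannian_count_ranks[OF x] of_nat_sum
    by (intro sum.cong refl) (use rank_ge_id[OF x] in \<open>auto simp: rank_id\<close>)
  also have "\<dots> = (\<Sum>p=1..n-1. \<Sum>i=1..p. real (x i) - real i)"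
  proof (rule sum.cong[OF refl])
    fix p assume "p \<in> {1..n-1}"
    then have "p \<le> n" by auto
    then show "(\<Sum>q=1..n-1. real (rank x p q) - real (rank id p q)) = (\<Sum>i=1..p. real (x i) - real i)"
      using sum_rank[OF x, of p] sum_rank[OF permutes_id, of p n] by (simp add: sum_subtractf)
  qed
  also have "\<dots> = (\<Sum>a=1..n-1. (real (x a) - real a) * (real n - real a))"
    by (rule sum_partial_sums)
  finally show ?thesis .
qed

theorem mainTheorem1:
  fixes n :: nat and x :: "nat \<Rightarrow> nat"
  assumes "n \<ge> 1" and "x permutes {1..n}"
  shows "real (bigrassmannian_count n x) =
           (\<Sum>a=1..n - 1. (real (x a) - real a) * (real n - real a))
       \<and> (\<Sum>a=1..n - 1. (real (x a) - real a) * (real n - real a)) =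
           1 / 2 * (\<Sum>a=1..n. (real (x a) - real a)\<^sup>2)
       \<and> 1 / 2 * (\<Sum>a=1..n. (real (x a) - real a)\<^sup>2) =
           (\<Sum>(i, j)\<in>inversions n x. real (x i) - real (x j))"
  using bigrassmannian_count_weighted[OF assms(2)] weighted_displacement_sum[OF assms]
    inversion_height_sum[OF assms(2)] by simp

end
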